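(* Let $m,q,s$ be positive integers satisfying $s>(m-1)q$ and $q<s$, put $n_0=\max\{mq,s\}$, and let $A(\boldsymbol\beta)$, $\boldsymbol\beta=(\beta_0,\dots,\beta_{m-1})\in[0,1]^m$, be the row-stochastic family of order $n_0$ constructed in the context. If $0<\beta_j<1$ for every $j=0,\ldots,m-1$, then $A(\boldsymbol\beta)$ is irreducible: every vertex can reach every other along a directed path whose arrow weights are positive. It has exactly $n_0+m$ positive entries: $m$ rows have two each, and the remaining $n_0-m$ rows have one each. If also $\gcd(q,s)=1$, the matrix is primitive: some positive integer $k$ makes every entry of $A(\boldsymbol\beta)^k$ strictly positive. For any $\boldsymbol\beta\in[0,1]^m$ and integer $n\ge n_0$, the block diagonal matrix $$A(\boldsymbol\beta)\oplus I_{n-n_0}=\begin{pmatrix}A(\boldsymbol\beta)&0\\0&I_{n-n_0}\end{pmatrix}$$ is row-stochastic of order $n$ and retains every eigenvalue of $A(\boldsymbol\beta)$ (when $n=n_0$, no block is added).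
   Context: Construction of $A(\boldsymbol\beta)$. A weighted directed graph defines a matrix indexed by its vertices: $A_{uv}$ is the sum of the weights of all arrows $u\to v$ (an empty sum is $0$). Put $\alpha_j=1-\beta_j$. For $j=0,\dots,m-1$ take a block of vertices $v_{j,0},\dots,v_{j,q-1}$; the block following block $m-1$ is block $0$. Within block $j$ draw arrows $v_{j,k}\to v_{j,k+1}$ of weight $1$ for $0\le k<q-1$. From the last vertex $v_{j,q-1}$ draw an arrow to $v_{j,0}$ of weight $\beta_j$ and, for $j<m-1$, an arrow to $v_{j+1,0}$ of weight $\alpha_j$. For $j=m-1$ the connecting arrow of weight $\alpha_{m-1}$ is as follows. If $s\le mq$, it goes from $v_{m-1,q-1}$ to $v_{0,d}$ with $d=mq-s$ (so $0\le d<q$), and no further vertices are added. If $s>mq$, it is replaced by a path from $v_{m-1,q-1}$ to $v_{0,0}$ through $s-mq$ new vertices, the first arrow of the path having weight $\alpha_{m-1}$ and all subsequent arrows weight $1$. The resulting graph has $n_0=\max\{mq,s\}$ vertices, and the matrix is row-stochastic (nonnegative with row sums $1$). *)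

theory Defs
  imports
    "Jordan_Normal_Form.Char_Poly"
    "Graph_Theory.Digraph_Component"
begin

section \<open>Weighted digraphs and matrices\<close>

text \<open>Parallel arcs are allowed, and their weights add up.\<close>

definition weight_mat :: "nat \<Rightarrow> (nat, 'e) pre_digraph \<Rightarrow> ('e \<Rightarrow> real) \<Rightarrow> real mat" where
  "weight_mat n G w =
     mat n n (\<lambda>(u, v). \<Sum>e\<in>{e \<in> arcs G. tail G e = u \<and> head G e = v}. w e)"

definition positive_subgraph :: "('v, 'e) pre_digraph \<Rightarrow> ('e \<Rightarrow> real) \<Rightarrow> ('v, 'e) pre_digraph" where
  "positive_subgraph G w = G\<lparr>arcs := {e \<in> arcs G. w e > 0}\<rparr>"

definition positive_entries :: "real mat \<Rightarrow> (nat \<times> nat) set" where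
  "positive_entries A = {(i, j). i < dim_row A \<and> j < dim_col A \<and> A $$ (i, j) > 0}"

definition mat_digraph :: "real mat \<Rightarrow> (nat, nat \<times> nat) pre_digraph" where
  "mat_digraph A = \<lparr>verts = {..<dim_row A}, arcs = positive_entries A, tail = fst, head = snd\<rparr>"

definition irreducible_mat :: "real mat \<Rightarrow> bool" where
  "irreducible_mat A \<longleftrightarrow> square_mat A \<and> strongly_connected (mat_digraph A)"

definition primitive_mat :: "real mat \<Rightarrow> bool" where
  "primitive_mat A \<longleftrightarrow> square_mat A \<and>
     (\<exists>k::nat. k > 0 \<and> (\<forall>i<dim_row A. \<forall>j<dim_col A. (A ^\<^sub>m k) $$ (i, j) > 0))"

definition row_stochastic :: "nat \<Rightarrow> real mat \<Rightarrow> bool" where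
  "row_stochastic n A \<longleftrightarrow> A \<in> carrier_mat n n \<and>
     (\<forall>i<n. \<forall>j<n. 0 \<le> A $$ (i, j)) \<and> (\<forall>i<n. (\<Sum>j<n. A $$ (i, j)) = 1)"

definition add_identity :: "real mat \<Rightarrow> nat \<Rightarrow> real mat" where
  "add_identity A k =
     four_block_mat A (0\<^sub>m (dim_row A) k) (0\<^sub>m k (dim_col A)) (1\<^sub>m k)"

definition complex_eigenvalue :: "real mat \<Rightarrow> complex \<Rightarrow> bool" where
  "complex_eigenvalue A z \<longleftrightarrow> eigenvalue (map_mat complex_of_real A) z"


section \<open>The block graph\<close>

text \<open>
  Vertices are numbered so that \<open>v\<^sub>j\<^sub>,\<^sub>k\<close> is \<open>j * q + k\<close>; the \<open>s - m * q\<close> vertices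
  added when \<open>s > m * q\<close> are \<open>m * q, m * q + 1, \<dots>, s - 1\<close>, in the order in which the
  added path visits them. Truncated subtraction makes this set empty when \<open>s \<le> m * q\<close>.
\<close>

definition block_vertex :: "nat \<Rightarrow> nat \<Rightarrow> nat \<Rightarrow> nat" where
  "block_vertex q j k = j * q + k"

definition new_vertex :: "nat \<Rightarrow> nat \<Rightarrow> nat \<Rightarrow> nat" where
  "new_vertex m q i = m * q + i"

text \<open>
  \<open>Step j k\<close> is the arrow from \<open>v\<^sub>j\<^sub>,\<^sub>k\<close> to \<open>v\<^sub>j\<^sub>,\<^sub>k\<^sub>+\<^sub>1\<close>. \<open>Back j\<close> and \<open>Connect j\<close> are the two
  arrows leaving the last vertex of block \<open>j\<close>, with weights \<open>\<beta> j\<close> and \<open>1 - \<beta> j\<close>.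
  \<open>Extra i\<close> is the arrow leaving the \<open>i\<close>-th new vertex.
\<close>

datatype arrow = Step nat nat | Back nat | Connect nat | Extra nat

primrec arrow_tail :: "nat \<Rightarrow> nat \<Rightarrow> arrow \<Rightarrow> nat" where
  "arrow_tail m q (Step j k) = block_vertex q j k"
| "arrow_tail m q (Back j) = block_vertex q j (q - 1)"
| "arrow_tail m q (Connect j) = block_vertex q j (q - 1)"
| "arrow_tail m q (Extra i) = new_vertex m q i"

primrec arrow_head :: "nat \<Rightarrow> nat \<Rightarrow> nat \<Rightarrow> arrow \<Rightarrow> nat" where
  "arrow_head m q s (Step j k) = block_vertex q j (k + 1)"
| "arrow_head m q s (Back j) = block_vertex q j 0"
| "arrow_head m q s (Connect j) =
     (if j < m - 1 then block_vertex q (j + 1) 0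
      else if s \<le> m * q then block_vertex q 0 (m * q - s)
      else new_vertex m q 0)"
| "arrow_head m q s (Extra i) =
     (if i + 1 < s - m * q then new_vertex m q (i + 1) else block_vertex q 0 0)"

primrec arrow_weight :: "(nat \<Rightarrow> real) \<Rightarrow> arrow \<Rightarrow> real" where
  "arrow_weight \<beta> (Step j k) = 1"
| "arrow_weight \<beta> (Back j) = \<beta> j"
| "arrow_weight \<beta> (Connect j) = 1 - \<beta> j"
| "arrow_weight \<beta> (Extra i) = 1"

definition graph_order :: "nat \<Rightarrow> nat \<Rightarrow> nat \<Rightarrow> nat" where
  "graph_order m q s = max (m * q) s"

definition block_graph :: "nat \<Rightarrow> nat \<Rightarrow> nat \<Rightarrow> (nat, arrow) pre_digraph" where
  "block_graph m q s =
     \<lparr>verts = {..<graph_order m q s},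
      arcs = {Step j k |j k. j < m \<and> k < q - 1} \<union> Back ` {..<m} \<union> Connect ` {..<m}
        \<union> Extra ` {..<s - m * q},
      tail = arrow_tail m q,
      head = arrow_head m q s\<rparr>"

definition block_mat :: "nat \<Rightarrow> nat \<Rightarrow> nat \<Rightarrow> (nat \<Rightarrow> real) \<Rightarrow> real mat" where
  "block_mat m q s \<beta> = weight_mat (graph_order m q s) (block_graph m q s) (arrow_weight \<beta>)"

end

theory Submission
  imports Defs "HOL-Number_Theory.Cong"
begin

text \<open>
  In the numbering of the definitions, every vertex \<open>u\<close> has an arrow to
  \<open>if u + 1 < n\<^sub>0 then u + 1 else n\<^sub>0 - s\<close>, and the last vertex \<open>u\<close> of each block has a second
  one to \<open>u + 1 - q\<close>. The first kind of arrow gives a path \<open>0, 1, \<dots>, n\<^sub>0 - 1\<close> that returns to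
  \<open>n\<^sub>0 - s < q\<close>, whence block \<open>0\<close> leads back to \<open>0\<close>. For primitivity, the vertex \<open>q - 1\<close> lies
  both on the cycle \<open>0, \<dots>, q - 1\<close> of length \<open>q\<close> and on the cycle \<open>n\<^sub>0 - s, \<dots>, n\<^sub>0 - 1\<close> of
  length \<open>s\<close>; when these lengths are coprime, it lies on closed walks of every large length.
\<close>

section \<open>Nonnegative matrices\<close>

lemma sum_pos_iff:
  fixes f :: "'a \<Rightarrow> real"
  assumes "finite S" "\<And>x. x \<in> S \<Longrightarrow> 0 \<le> f x"
  shows "0 < sum f S \<longleftrightarrow> (\<exists>x\<in>S. 0 < f x)"
  using sum_nonneg[of S f] sum_nonneg_eq_0_iff[of S f] assms by (force simp: less_le)

text \<open>An entry of \<open>A^k\<close> sums products along walks of length \<open>k\<close>, and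
  nonnegative terms cannot cancel. Nonnegativity is carried through the induction because a positive
  product has two positive factors only when negative ones are excluded.\<close>

lemma positive_entries_power:
  assumes A: "A \<in> carrier_mat n n"
    and nonneg: "\<And>i j. i < n \<Longrightarrow> j < n \<Longrightarrow> 0 \<le> A $$ (i, j)"
    and "i < n" "j < n"
  shows "0 \<le> (A ^\<^sub>m k) $$ (i, j) \<and>
    (0 < (A ^\<^sub>m k) $$ (i, j) \<longleftrightarrow> (i, j) \<in> positive_entries A ^^ k)"
  using \<open>j < n\<close>
proof (induction k arbitrary: j)
  case 0
  then show ?case using A \<open>i < n\<close> by auto
next
  case (Suc k)
  let ?B = "A ^\<^sub>m k"
  have B: "?B \<in> carrier_mat n n" using A by (metis pow_carrier_mat)
  \<comment> \<open>Splitting off the last factor matches \<open>relpow\<close>, which adds its new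
    step at the end.\<close>
  have entry: "(A ^\<^sub>m Suc k) $$ (i, j) = (\<Sum>l<n. ?B $$ (i, l) * A $$ (l, j))"
    using A B \<open>i < n\<close> Suc.prems by (auto simp: scalar_prod_def lessThan_atLeast0 intro!: sum.cong)
  have terms: "0 \<le> ?B $$ (i, l) * A $$ (l, j)" if "l < n" for l
    using Suc.IH[OF that] nonneg[OF that Suc.prems] by simp
  have "0 < (A ^\<^sub>m Suc k) $$ (i, j) \<longleftrightarrow> (\<exists>l<n. 0 < ?B $$ (i, l) * A $$ (l, j))"
    unfolding entry using terms by (subst sum_pos_iff) auto
  also have "\<dots> \<longleftrightarrow> (\<exists>l<n. 0 < ?B $$ (i, l) \<and> 0 < A $$ (l, j))"
    using Suc.IH nonneg[OF _ Suc.prems] by (auto simp: zero_less_mult_iff) force+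
  also have "\<dots> \<longleftrightarrow> (\<exists>l. (i, l) \<in> positive_entries A ^^ k \<and> (l, j) \<in> positive_entries A)"
    using Suc.IH Suc.prems A by (auto simp: positive_entries_def)
  finally show ?case
    unfolding entry using terms by (auto intro!: sum_nonneg simp: entry)
qed

section \<open>Primitivity from two coprime closed walks\<close>

text \<open>Choose \<open>b\<close> as the residue of \<open>k / q\<close> modulo \<open>p\<close>:
  then \<open>k - b * q\<close> is a multiple of \<open>p\<close>, and it is nonnegative since
  \<open>b < p\<close>. The bound \<open>p * q\<close> is cruder than the Frobenius number, but any
  bound serves for primitivity.\<close>

lemma coprime_combination_nat:
  fixes p q k :: nat
  assumes "coprime p q" "p > 0" "p * q \<le> k"
  obtains a b where "k = a * p + b * q"
proof -
  obtain x where x: "[q * x = 1] (mod p)"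
    using cong_solve_coprime_nat[of q p] assms(1) by (auto simp: coprime_commute)
  define b where "b = (k * x) mod p"
  have "b < p" using assms(2) by (simp add: b_def)
  then have "b * q \<le> p * q" by (intro mult_le_mono1) simp
  with assms(3) have le: "b * q \<le> k" by (rule order_trans[rotated])
  have "[b * q = k * x * q] (mod p)" unfolding b_def by (simp add: cong_def mod_mult_left_eq)
  also have "[k * x * q = k * 1] (mod p)"
    using cong_mult[OF cong_refl[of k p] x] by (simp add: ac_simps)
  finally have "p dvd k - b * q" using le by (simp add: cong_altdef_nat cong_sym_eq)
  then obtain a where "k - b * q = p * a" by blast
  with le that[of a b] show thesis by (simp add: ac_simps)
qed

lemma relpow_loop: "(v, v) \<in> R ^^ p \<Longrightarrow> (v, v) \<in> R ^^ (a * p)"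
proof (induction a)
  case (Suc a)
  then show ?case unfolding mult_Suc relpow_add by blast
qed simp

lemma reachable_imp_relpow: "u \<rightarrow>\<^sup>*\<^bsub>G\<^esub> v \<Longrightarrow> \<exists>k. (u, v) \<in> arcs_ends G ^^ k"
  using reachable_rtranclI by (auto simp: rtrancl_power)

lemma arcs_ends_mat_digraph: "arcs_ends (mat_digraph A) = positive_entries A"
  by (auto simp: arcs_ends_conv mat_digraph_def)

text \<open>Go from \<open>i\<close> to \<open>v\<close>, fill up with closed walks at
  \<open>v\<close>, then go from \<open>v\<close> to \<open>j\<close>. The filling can have every
  length from \<open>p * q\<close> on, so all pairs can be joined by walks of one common
  length.\<close>

lemma primitive_mat_coprime_cycles:
  assumes A: "A \<in> carrier_mat n n"
    and nonneg: "\<And>i j. i < n \<Longrightarrow> j < n \<Longrightarrow> 0 \<le> A $$ (i, j)"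
    and irr: "irreducible_mat A" and "v < n"
    and p: "(v, v) \<in> positive_entries A ^^ p" "p > 0"
    and q: "(v, v) \<in> positive_entries A ^^ q"
    and "coprime p q"
  shows "primitive_mat A"
proof -
  let ?R = "positive_entries A"
  have walk: "\<exists>k. (i, j) \<in> ?R ^^ k" if "i < n" "j < n" for i j
    using irr that A reachable_imp_relpow[of "mat_digraph A" i j]
    by (auto simp: irreducible_mat_def strongly_connected_def arcs_ends_mat_digraph)
       (auto simp: mat_digraph_def)
  have "\<forall>i\<in>{..<n}. \<exists>k. (i, v) \<in> ?R ^^ k" using walk \<open>v < n\<close> by blast
  from bchoice[OF this] obtain f where f: "\<And>i. i < n \<Longrightarrow> (i, v) \<in> ?R ^^ f i" by blast
  have "\<forall>j\<in>{..<n}. \<exists>k. (v, j) \<in> ?R ^^ k" using walk \<open>v < n\<close> by blast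
  from bchoice[OF this] obtain g where g: "\<And>j. j < n \<Longrightarrow> (v, j) \<in> ?R ^^ g j" by blast
  \<comment> \<open>The two sums dominate each \<open>f i\<close> and each \<open>g j\<close>, so at
    least \<open>p * q\<close> is left for the closed walks at \<open>v\<close>, whatever the pair.
    \<open>Suc\<close> makes the exponent positive.\<close>
  define K where "K = Suc (p * q + sum f {..<n} + sum g {..<n})"
  have "(i, j) \<in> ?R ^^ K" if "i < n" "j < n" for i j
  proof -
    have "f i \<le> sum f {..<n}" "g j \<le> sum g {..<n}"
      using that by (auto intro!: member_le_sum)
    then have K: "K = f i + ((K - f i - g j) + g j)" and "p * q \<le> K - f i - g j"
      by (auto simp: K_def)
    then obtain a b where "K - f i - g j = a * p + b * q"
      using coprime_combination_nat \<open>coprime p q\<close> \<open>p > 0\<close> by blast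
    then have "(v, v) \<in> ?R ^^ (K - f i - g j)"
      using relpow_loop[OF p(1), of a] relpow_loop[OF q, of b] by (auto simp: relpow_add)
    with f[OF \<open>i < n\<close>] g[OF \<open>j < n\<close>] show ?thesis
      by (subst K) (auto simp: relpow_add)
  qed
  then have "0 < (A ^\<^sub>m K) $$ (i, j)" if "i < n" "j < n" for i j
    using positive_entries_power[OF A nonneg that] that by blast
  moreover have "0 < K" by (simp add: K_def)
  ultimately show ?thesis using A unfolding primitive_mat_def by auto
qed

section \<open>Weight matrices\<close>

lemma weight_mat_carrier [simp]: "weight_mat n G w \<in> carrier_mat n n"
  by (simp add: weight_mat_def)

lemma weight_mat_nonneg:
  assumes "\<And>e. e \<in> arcs G \<Longrightarrow> 0 \<le> w e" "i < n" "j < n"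
  shows "0 \<le> weight_mat n G w $$ (i, j)"
  using assms by (auto simp: weight_mat_def intro!: sum_nonneg)

text \<open>Weights of parallel arrows add up without cancellation because none is negative.\<close>

lemma weight_mat_positive_iff:
  assumes "finite (arcs G)" "\<And>e. e \<in> arcs G \<Longrightarrow> 0 \<le> w e" "i < n" "j < n"
  shows "0 < weight_mat n G w $$ (i, j) \<longleftrightarrow> (\<exists>e\<in>arcs G. tail G e = i \<and> head G e = j \<and> 0 < w e)"
proof -
  let ?E = "{e \<in> arcs G. tail G e = i \<and> head G e = j}"
  have "finite ?E" "\<And>e. e \<in> ?E \<Longrightarrow> 0 \<le> w e" using assms by auto
  then have "0 < sum w ?E \<longleftrightarrow> (\<exists>e\<in>?E. 0 < w e)"
    by (rule sum_pos_iff)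
  then show ?thesis using assms(3,4) by (auto simp: weight_mat_def)
qed

text \<open>Group the arrows leaving \<open>i\<close> by their heads. No arrow is lost, since all
  heads lie below \<open>n\<close>.\<close>

lemma row_sum_weight_mat:
  assumes "finite (arcs G)" "\<And>e. e \<in> arcs G \<Longrightarrow> head G e < n" "i < n"
  shows "(\<Sum>j<n. weight_mat n G w $$ (i, j)) = (\<Sum>e\<in>{e \<in> arcs G. tail G e = i}. w e)"
proof -
  let ?E = "{e \<in> arcs G. tail G e = i}"
  have "(\<Sum>j<n. weight_mat n G w $$ (i, j)) = (\<Sum>j<n. \<Sum>e\<in>{e \<in> ?E. head G e = j}. w e)"
    using assms(3) by (auto simp: weight_mat_def conj_assoc intro!: sum.cong)
  also have "\<dots> = (\<Sum>e\<in>?E. w e)"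
    by (rule sum.group) (use assms in auto)
  finally show ?thesis .
qed

section \<open>Adjoining an identity block\<close>

lemma row_stochastic_add_identity:
  assumes "row_stochastic n A"
  shows "row_stochastic (n + k) (add_identity A k)"
proof -
  have A: "A \<in> carrier_mat n n" using assms by (simp add: row_stochastic_def)
  have split: "(\<Sum>j<n + k. f j) = (\<Sum>j<n. f j) + (\<Sum>j<k. f (n + j))" for f :: "nat \<Rightarrow> real"
    by (induction k) (simp_all add: add.assoc)
  have rows: "(\<Sum>j<n + k. add_identity A k $$ (i, j)) = 1" if "i < n + k" for i
  proof -
    have "(\<Sum>j<n + k. add_identity A k $$ (i, j)) =
        (\<Sum>j<n. add_identity A k $$ (i, j)) + (\<Sum>j<k. add_identity A k $$ (i, n + j))"
      by (rule split)
    also have "\<dots> = 1"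
    proof (cases "i < n")
      case True
      then have "(\<Sum>j<n. add_identity A k $$ (i, j)) = (\<Sum>j<n. A $$ (i, j))"
        "(\<Sum>j<k. add_identity A k $$ (i, n + j)) = 0"
        using A by (auto simp: add_identity_def)
      with True assms show ?thesis by (simp add: row_stochastic_def)
    next
      case False
      then have "(\<Sum>j<n. add_identity A k $$ (i, j)) = 0"
        "(\<Sum>j<k. add_identity A k $$ (i, n + j)) = (\<Sum>j<k. if j = i - n then 1 else 0)"
        using A that by (auto simp: add_identity_def intro!: sum.cong)
      with False that show ?thesis by (simp add: sum.delta)
    qed
    finally show ?thesis .
  qed
  have "add_identity A k \<in> carrier_mat (n + k) (n + k)"
    using A by (auto simp: add_identity_def)
  moreover have "0 \<le> add_identity A k $$ (i, j)" if "i < n + k" "j < n + k" for i j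
    using assms A that by (auto simp: add_identity_def row_stochastic_def)
  ultimately show ?thesis using rows by (simp add: row_stochastic_def)
qed

text \<open>Pad an eigenvector with zeros. The identity block sees only the zero part, which
  satisfies the eigenvalue equation for any \<open>z\<close>.\<close>

lemma complex_eigenvalue_add_identity:
  assumes A: "A \<in> carrier_mat n n" and "complex_eigenvalue A z"
  shows "complex_eigenvalue (add_identity A k) z"
proof -
  let ?C = "map_mat complex_of_real"
  have C: "?C A \<in> carrier_mat n n" using A by simp
  obtain v where v: "v \<in> carrier_vec n" "v \<noteq> 0\<^sub>v n" "?C A *\<^sub>v v = z \<cdot>\<^sub>v v"
    using assms by (auto simp: complex_eigenvalue_def eigenvalue_def eigenvector_def)
  have block: "?C (add_identity A k) = four_block_mat (?C A) (0\<^sub>m n k) (0\<^sub>m k n) (1\<^sub>m k)"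
    using A by (auto simp: add_identity_def)
  have "?C (add_identity A k) *\<^sub>v (v @\<^sub>v 0\<^sub>v k) = (?C A *\<^sub>v v) @\<^sub>v (1\<^sub>m k *\<^sub>v 0\<^sub>v k)"
    unfolding block by (rule mult_mat_vec_split[OF C _ v(1)]) auto
  also have "\<dots> = z \<cdot>\<^sub>v (v @\<^sub>v 0\<^sub>v k)"
    using v by auto
  finally have "?C (add_identity A k) *\<^sub>v (v @\<^sub>v 0\<^sub>v k) = z \<cdot>\<^sub>v (v @\<^sub>v 0\<^sub>v k)" .
  moreover have "v @\<^sub>v 0\<^sub>v k \<noteq> 0\<^sub>v (n + k)"
  proof
    assume "v @\<^sub>v 0\<^sub>v k = 0\<^sub>v (n + k)"
    then have "v $ i = 0" if "i < n" for i
      using that v(1)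
      by (metis carrier_vecD index_append_vec(1) index_zero_vec trans_less_add1)
    with v(1,2) show False by (auto intro: eq_vecI)
  qed
  ultimately show ?thesis
    using A v(1) unfolding complex_eigenvalue_def eigenvalue_def eigenvector_def
    by (intro exI[of _ "v @\<^sub>v 0\<^sub>v k"]) (auto simp: add_identity_def)
qed

section \<open>The block graph\<close>

locale block_parameters =
  fixes m q s n :: nat
  assumes m: "m > 0" and q: "q > 0" "q < s" and s: "(m - 1) * q < s"
  defines "n \<equiv> graph_order m q s"
begin

text \<open>One formula for both shapes of the graph: \<open>n - s\<close> is
  \<open>d = m * q - s\<close> if \<open>s \<le> m * q\<close>, and it is \<open>0\<close> if the
  added path exists.\<close>

definition next_vertex :: "nat \<Rightarrow> nat" where
  "next_vertex u = (if Suc u < n then Suc u else n - s)"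

text \<open>The bound \<open>u < m * q\<close> keeps out new vertices, whose numbers may also be
  congruent to \<open>q - 1\<close>.\<close>

definition block_end :: "nat \<Rightarrow> bool" where
  "block_end u \<longleftrightarrow> u < m * q \<and> u mod q = q - 1"

text \<open>The hypothesis \<open>(m - 1) * q < s\<close> gives \<open>n - s < q\<close>: the
  closing arrow always lands in block \<open>0\<close>.\<close>

lemma vertex_bounds: "n - s < q" "s \<le> n" "m * q \<le> n" "q \<le> m * q"
  using m q s by (cases m; auto simp: n_def graph_order_def)+

lemma block_endE:
  assumes "block_end u"
  obtains j where "j < m" "u = j * q + (q - 1)" "u div q = j"
proof -
  have "u = u div q * q + (q - 1)" using assms by (metis block_end_def div_mult_mod_eq)
  moreover have "u div q < m" using assms q by (auto simp: block_end_def less_mult_imp_div_less)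
  ultimately show thesis using that by blast
qed

lemma block_bound: "j < m \<Longrightarrow> k < q \<Longrightarrow> j * q + k < m * q"
  by (metis add_strict_left_mono le_trans less_le_trans mult_Suc mult_le_mono1 Suc_leI add.commute)

text \<open>The left sides have the form to which simplification brings
  \<open>j * q + (q - 1)\<close>.\<close>

lemma block_last_div_mod [simp]:
  "(j * q + q - Suc 0) div q = j" "(j * q + q - Suc 0) mod q = q - Suc 0"
proof -
  have eq: "j * q + q - Suc 0 = (q - 1) + j * q" using q by simp
  show "(j * q + q - Suc 0) div q = j"
    using q unfolding eq by (subst div_mult_self1) auto
  show "(j * q + q - Suc 0) mod q = q - Suc 0"
    using q unfolding eq by (subst mod_mult_self1) auto
qed

lemma block_end_iff: "block_end u \<longleftrightarrow> (\<exists>j<m. u = j * q + (q - 1))"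
proof
  assume "block_end u"
  then show "\<exists>j<m. u = j * q + (q - 1)" by (rule block_endE) blast
next
  assume "\<exists>j<m. u = j * q + (q - 1)"
  then show "block_end u" using q block_bound[of _ "q - 1"] by (auto simp: block_end_def)
qed

lemma card_block_ends: "card {u. u < n \<and> block_end u} = m"
proof -
  have "{u. u < n \<and> block_end u} = (\<lambda>j. j * q + (q - 1)) ` {..<m}"
    using vertex_bounds q block_bound[of _ "q - 1"]
    by (auto simp: block_end_iff intro: less_le_trans)
  moreover have "inj_on (\<lambda>j. j * q + (q - 1)) {..<m}"
    using q by (auto simp: inj_on_def simp del: add_diff_assoc)
  ultimately show ?thesis by (simp only: card_image card_lessThan)
qed

section \<open>Arrows leaving a vertex\<close>

lemma finite_arcs: "finite (arcs (block_graph m q s))"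
proof -
  have "{Step j k |j k. j < m \<and> k < q - 1} = (\<lambda>(j, k). Step j k) ` ({..<m} \<times> {..<q - 1})"
    by auto
  then show ?thesis by (simp add: block_graph_def)
qed

text \<open>Division by \<open>q\<close> recovers block and position from the number of a block
  vertex. Hence the tail determines the arrow, except at a block end, which \<open>Back\<close> and
  \<open>Connect\<close> share.\<close>

lemma arcs_from:
  assumes "u < n"
  shows "{e \<in> arcs (block_graph m q s). tail (block_graph m q s) e = u} =
    (if block_end u then {Back (u div q), Connect (u div q)}
     else if u < m * q then {Step (u div q) (u mod q)} else {Extra (u - m * q)})"
    (is "?L = ?R")
proof -
  have mod: "u mod q < q" using q by simp
  have split: "u = u div q * q + u mod q" by simp
  have div: "u div q < m" if "u < m * q" using that q by (simp add: less_mult_imp_div_less)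
  have last: "u div q * q + (q - 1) = u" if "u mod q = q - 1"
    using that by (metis div_mult_mod_eq)
  have upper: "u - m * q < s - m * q" if "\<not> u < m * q"
    using that assms by (auto simp: n_def graph_order_def)
  have "e \<in> ?L \<longleftrightarrow> e \<in> ?R" for e
  proof (cases e)
    case (Step j k)
    show ?thesis
      using q block_bound[of j k] mod split div
      by (auto simp: Step block_graph_def block_vertex_def block_end_def)
  next
    case (Back j)
    show ?thesis
      using q block_bound[of j "q - 1"] last div
      by (auto simp: Back block_graph_def block_vertex_def block_end_def)
  next
    case (Connect j)
    show ?thesis
      using q block_bound[of j "q - 1"] last div
      by (auto simp: Connect block_graph_def block_vertex_def block_end_def)
  next
    case (Extra i)
    show ?thesis
      using upper by (auto simp: Extra block_graph_def new_vertex_def block_end_def)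
  qed
  then show ?thesis by blast
qed

lemma head_Back: "block_end u \<Longrightarrow> arrow_head m q s (Back (u div q)) = Suc u - q"
  using q by (auto elim!: block_endE simp: block_vertex_def)

text \<open>Before the last block, \<open>Suc u\<close> starts the next block. In the last block
  \<open>Suc u = m * q\<close>, which is below \<open>n\<close> exactly when new vertices exist;
  otherwise the head is \<open>m * q - s = n - s\<close>.\<close>

lemma head_Connect:
  assumes "block_end u"
  shows "arrow_head m q s (Connect (u div q)) = next_vertex u"
proof -
  obtain j where j: "j < m" "u = j * q + (q - 1)" "u div q = j"
    using assms by (rule block_endE)
  then have u: "Suc u = Suc j * q" using q by simp
  show ?thesis
  proof (cases "j < m - 1")
    case True
    then have "Suc j * q < m * q" using q by (intro mult_strict_right_mono) auto
    then show ?thesis using True j u vertex_bounds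
      by (auto simp: next_vertex_def block_vertex_def)
  next
    case False
    with j have "Suc j = m" by simp
    then show ?thesis using False j(3) u
      by (auto simp: next_vertex_def block_vertex_def new_vertex_def n_def graph_order_def)
  qed
qed

text \<open>The vertex \<open>m * q - 1\<close> is a block end, so \<open>u\<close> differs from it
  and \<open>Suc u\<close> is still a block vertex.\<close>

lemma head_Step:
  assumes "u < m * q" "\<not> block_end u"
  shows "arrow_head m q s (Step (u div q) (u mod q)) = next_vertex u"
proof -
  have "m * q - 1 = (m - 1) * q + (q - 1)" using m q by (cases m) auto
  then have "block_end (m * q - 1)" unfolding block_end_iff using m
    by (intro exI[of _ "m - 1"]) simp
  with assms have "Suc u < m * q" by (metis Suc_lessI diff_Suc_1)
  then show ?thesis using vertex_bounds by (simp add: next_vertex_def block_vertex_def)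
qed

text \<open>A vertex beyond the blocks exists only if \<open>n = s\<close>, so the path closes at
  \<open>n - s = 0\<close>.\<close>

lemma head_Extra:
  assumes "u < n" "\<not> u < m * q"
  shows "arrow_head m q s (Extra (u - m * q)) = next_vertex u"
  using assms by (auto simp: next_vertex_def new_vertex_def block_vertex_def n_def graph_order_def)

lemma heads_from:
  assumes "u < n"
  shows "head (block_graph m q s) ` {e \<in> arcs (block_graph m q s). tail (block_graph m q s) e = u} =
    (if block_end u then {next_vertex u, Suc u - q} else {next_vertex u})"
proof -
  have "head (block_graph m q s) = arrow_head m q s" by (simp add: block_graph_def)
  then show ?thesis
    using assms head_Back[of u] head_Connect[of u] head_Step[of u] head_Extra[of u]
    by (auto simp: arcs_from simp del: arrow_head.simps)
qed

lemma tail_less: "e \<in> arcs (block_graph m q s) \<Longrightarrow> tail (block_graph m q s) e < n"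
proof (cases e)
  case (Step j k)
  assume "e \<in> arcs (block_graph m q s)"
  then have "j * q + k < m * q" by (intro block_bound) (auto simp: Step block_graph_def)
  then show ?thesis using vertex_bounds(3) by (simp add: Step block_graph_def block_vertex_def)
next
  case (Back j)
  assume "e \<in> arcs (block_graph m q s)"
  then have "j * q + (q - 1) < m * q"
    using q by (intro block_bound) (auto simp: Back block_graph_def)
  then show ?thesis using vertex_bounds(3) by (simp add: Back block_graph_def block_vertex_def)
next
  case (Connect j)
  assume "e \<in> arcs (block_graph m q s)"
  then have "j * q + (q - 1) < m * q"
    using q by (intro block_bound) (auto simp: Connect block_graph_def)
  then show ?thesis using vertex_bounds(3) by (simp add: Connect block_graph_def block_vertex_def)
next
  case (Extra i)
  assume "e \<in> arcs (block_graph m q s)"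
  then show ?thesis by (auto simp: Extra block_graph_def new_vertex_def n_def graph_order_def)
qed

lemma next_vertex_less: "u < n \<Longrightarrow> next_vertex u < n"
  using q by (auto simp: next_vertex_def n_def graph_order_def)

lemma head_less:
  assumes "e \<in> arcs (block_graph m q s)"
  shows "head (block_graph m q s) e < n"
proof -
  let ?u = "tail (block_graph m q s) e"
  have "head (block_graph m q s) e \<in> {next_vertex ?u, Suc ?u - q}"
    using heads_from[OF tail_less[OF assms]] assms by (auto split: if_splits)
  then show ?thesis using tail_less[OF assms] next_vertex_less q by auto
qed

text \<open>The two arrows at a block end do not merge into one entry. If \<open>Suc u < n\<close>,
  their heads differ by \<open>q > 0\<close>; if \<open>Suc u = n\<close>, they are
  \<open>n - s\<close> and \<open>n - q\<close>, which differ because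
  \<open>q < s \<le> n\<close>.\<close>

lemma next_vertex_neq:
  assumes "u < n" "block_end u"
  shows "next_vertex u \<noteq> Suc u - q"
proof -
  have "q \<le> Suc u" using assms by (auto elim!: block_endE)
  then show ?thesis using assms(1) q vertex_bounds by (auto simp: next_vertex_def)
qed

lemma arrow_weight_nonneg:
  assumes "\<forall>j<m. 0 \<le> \<beta> j \<and> \<beta> j \<le> 1" "e \<in> arcs (block_graph m q s)"
  shows "0 \<le> arrow_weight \<beta> e"
  using assms by (auto simp: block_graph_def)

text \<open>A vertex has either one outgoing arrow of weight \<open>1\<close> or two of weights
  \<open>\<beta> j\<close> and \<open>1 - \<beta> j\<close>.\<close>

lemma row_stochastic_block_mat:
  assumes "\<forall>j<m. 0 \<le> \<beta> j \<and> \<beta> j \<le> 1"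
  shows "row_stochastic n (block_mat m q s \<beta>)"
proof -
  have "(\<Sum>j<n. block_mat m q s \<beta> $$ (u, j)) = 1" if "u < n" for u
    using row_sum_weight_mat[OF finite_arcs head_less that]
    by (simp add: block_mat_def n_def[symmetric] arcs_from[OF that])
  then show ?thesis
    using weight_mat_nonneg[OF arrow_weight_nonneg[OF assms]]
    by (auto simp: row_stochastic_def block_mat_def n_def[symmetric])
qed

section \<open>Supports for parameters strictly between 0 and 1\<close>

context
  fixes \<beta> :: "nat \<Rightarrow> real"
  assumes \<beta>: "\<forall>j<m. 0 < \<beta> j \<and> \<beta> j < 1"
begin

lemma arrow_weight_pos: "e \<in> arcs (block_graph m q s) \<Longrightarrow> 0 < arrow_weight \<beta> e"
  using \<beta> by (auto simp: block_graph_def)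

lemma positive_row:
  assumes "u < n"
  shows "{v. v < n \<and> 0 < block_mat m q s \<beta> $$ (u, v)} =
    (if block_end u then {next_vertex u, Suc u - q} else {next_vertex u})"
proof -
  have "0 < block_mat m q s \<beta> $$ (u, v) \<longleftrightarrow>
      (\<exists>e\<in>arcs (block_graph m q s). tail (block_graph m q s) e = u \<and> head (block_graph m q s) e = v)"
    if "v < n" for v
    unfolding block_mat_def n_def[symmetric]
    using weight_mat_positive_iff[OF finite_arcs less_imp_le[OF arrow_weight_pos] assms that]
      arrow_weight_pos by auto
  then show ?thesis
    unfolding heads_from[OF assms, symmetric] using head_less by (auto simp: image_iff)
qed

lemma card_positive_row:
  assumes "u < n"
  shows "card {v. v < n \<and> 0 < block_mat m q s \<beta> $$ (u, v)} = (if block_end u then 2 else 1)"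
  using next_vertex_neq[OF assms] by (simp add: positive_row[OF assms])

lemma block_mat_dim: "block_mat m q s \<beta> \<in> carrier_mat n n"
  by (simp add: block_mat_def n_def)

lemma positive_entries_block_mat:
  "positive_entries (block_mat m q s \<beta>) =
    (SIGMA u:{..<n}. if block_end u then {next_vertex u, Suc u - q} else {next_vertex u})"
  using block_mat_dim positive_row by (auto simp: positive_entries_def split: if_splits)

text \<open>All weights are positive, so no arrow is dropped. This lets one walk argument serve both
  the graph and the matrix form of irreducibility.\<close>

lemma arcs_ends_positive_subgraph:
  "arcs_ends (positive_subgraph (block_graph m q s) (arrow_weight \<beta>)) =
    positive_entries (block_mat m q s \<beta>)"
proof -
  let ?G = "block_graph m q s"
  have "arcs_ends (positive_subgraph ?G (arrow_weight \<beta>)) = arcs_ends ?G"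
    using arrow_weight_pos by (auto simp: arcs_ends_conv positive_subgraph_def)
  also have "\<dots> = (SIGMA u:{..<n}. head ?G ` {e \<in> arcs ?G. tail ?G e = u})"
    using tail_less by (auto simp: arcs_ends_conv)
  also have "\<dots> = positive_entries (block_mat m q s \<beta>)"
    unfolding positive_entries_block_mat by (intro Sigma_cong refl heads_from) simp
  finally show ?thesis .
qed

lemma card_positive_entries: "card (positive_entries (block_mat m q s \<beta>)) = n + m"
proof -
  have "card (positive_entries (block_mat m q s \<beta>)) = (\<Sum>u<n. if block_end u then 2 else 1)"
    unfolding positive_entries_block_mat using next_vertex_neq
    by (subst card_SigmaI) (auto intro!: sum.cong)
  \<comment> \<open>One entry for every row and an additional one for each block end.\<close>
  also have "\<dots> = (\<Sum>u<n. 1 + (if block_end u then 1 else 0))"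
    by (intro sum.cong) auto
  also have "\<dots> = n + card {u. u < n \<and> block_end u}"
    by (simp only: sum.distrib) (simp add: sum.If_cases Int_def)
  finally show ?thesis by (simp add: card_block_ends)
qed

lemma card_double_rows:
  "card {u. u < n \<and> card {v. v < n \<and> 0 < block_mat m q s \<beta> $$ (u, v)} = 2} = m"
proof -
  have "{u. u < n \<and> card {v. v < n \<and> 0 < block_mat m q s \<beta> $$ (u, v)} = 2} =
      {u. u < n \<and> block_end u}"
    by (auto simp: card_positive_row split: if_splits)
  then show ?thesis by (simp add: card_block_ends)
qed

lemma card_single_rows:
  "card {u. u < n \<and> card {v. v < n \<and> 0 < block_mat m q s \<beta> $$ (u, v)} = 1} = n - m"
proof -
  have "{u. u < n \<and> card {v. v < n \<and> 0 < block_mat m q s \<beta> $$ (u, v)} = 1} =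
      {..<n} - {u. u < n \<and> block_end u}"
    by (auto simp: card_positive_row split: if_splits)
  also have "card \<dots> = n - card {u. u < n \<and> block_end u}"
    by (subst card_Diff_subset) auto
  finally show ?thesis by (simp only: card_block_ends)
qed

section \<open>Walks, irreducibility and primitivity\<close>

lemma positive_next: "u < n \<Longrightarrow> (u, next_vertex u) \<in> positive_entries (block_mat m q s \<beta>)"
  by (simp add: positive_entries_block_mat)

lemma positive_back: "(q - 1, 0) \<in> positive_entries (block_mat m q s \<beta>)"
proof -
  have "block_end (q - 1)" using m by (auto simp: block_end_iff)
  then show ?thesis using q vertex_bounds by (auto simp: positive_entries_block_mat)
qed

text \<open>Below \<open>n - 1\<close> the next vertex is the successor number. The exact length is
  recorded for the cycle lengths below.\<close>

lemma forward_walk: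
  "v < n \<Longrightarrow> u \<le> v \<Longrightarrow> (u, v) \<in> positive_entries (block_mat m q s \<beta>) ^^ (v - u)"
proof (induction v)
  case (Suc v)
  show ?case
  proof (cases "u = Suc v")
    case False
    with Suc have "(u, v) \<in> positive_entries (block_mat m q s \<beta>) ^^ (v - u)" by simp
    moreover have "(v, Suc v) \<in> positive_entries (block_mat m q s \<beta>)"
      using positive_next[of v] Suc.prems by (simp add: next_vertex_def)
    ultimately show ?thesis using False Suc.prems by (auto simp: Suc_diff_le)
  qed simp
qed simp

lemma short_cycle: "(q - 1, q - 1) \<in> positive_entries (block_mat m q s \<beta>) ^^ q"
proof -
  have "(q - 1, q - 1) \<in> positive_entries (block_mat m q s \<beta>) ^^ Suc (q - 1)"
    \<comment> \<open>The arrow from \<open>q - 1\<close> back to \<open>0\<close> comes first,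
      followed by \<open>q - 1\<close> steps up.\<close>
    using positive_back forward_walk[of "q - 1" 0] vertex_bounds q
    by (intro relpow_Suc_I2[of _ 0]) auto
  then show ?thesis using q by simp
qed

lemma long_cycle: "(q - 1, q - 1) \<in> positive_entries (block_mat m q s \<beta>) ^^ s"
proof -
  let ?R = "positive_entries (block_mat m q s \<beta>)"
  have bounds: "q - 1 \<le> n - 1" "n - s \<le> q - 1" "n - 1 < n" "q - 1 < n"
    using vertex_bounds q by auto
  have "(n - 1, n - s) \<in> ?R"
    using positive_next[of "n - 1"] bounds by (simp add: next_vertex_def)
  \<comment> \<open>The walk climbs to \<open>n - 1\<close> and takes the closing arrow. Since
    \<open>n - s \<le> q - 1\<close>, it can then climb back to its start.\<close>
  then have "(q - 1, n - s) \<in> ?R ^^ Suc (n - 1 - (q - 1))"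
    using forward_walk[of "n - 1" "q - 1"] bounds by auto
  then have "(q - 1, q - 1) \<in> ?R ^^ (Suc (n - 1 - (q - 1)) + (q - 1 - (n - s)))"
    using forward_walk[of "q - 1" "n - s"] bounds unfolding relpow_add by blast
  moreover have "Suc (n - 1 - (q - 1)) + (q - 1 - (n - s)) = s"
    using vertex_bounds bounds q by linarith
  ultimately show ?thesis by (simp only:)
qed

text \<open>The route is \<open>u\<close>, up to \<open>n - 1\<close>, over to \<open>n - s\<close>,
  up to \<open>q - 1\<close>, back to \<open>0\<close>, up to \<open>v\<close>.\<close>

lemma walk_exists:
  assumes "u < n" "v < n"
  shows "(u, v) \<in> (positive_entries (block_mat m q s \<beta>))\<^sup>*"
proof -
  let ?R = "positive_entries (block_mat m q s \<beta>)"
  have forward: "(x, y) \<in> ?R\<^sup>*" if "x \<le> y" "y < n" for x y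
    using forward_walk[OF that(2,1)] by (rule relpow_imp_rtrancl)
  have "(u, n - 1) \<in> ?R\<^sup>*" using forward assms by auto
  also have "(n - 1, n - s) \<in> ?R"
    using positive_next[of "n - 1"] assms by (simp add: next_vertex_def)
  also have "(n - s, q - 1) \<in> ?R\<^sup>*" using forward vertex_bounds q by auto
  also have "(q - 1, 0) \<in> ?R" by (rule positive_back)
  also have "(0, v) \<in> ?R\<^sup>*" using forward assms by auto
  finally show ?thesis .
qed

text \<open>Digraph reachability requires all visited vertices to belong to the graph; positive
  entries never leave the index range.\<close>

lemma walk_exists_on:
  assumes "u < n" "v < n"
  shows "(u, v) \<in> rtrancl_on {..<n} (positive_entries (block_mat m q s \<beta>))"
  using walk_exists[OF assms]
proof (induction rule: rtrancl_induct)
  case base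
  then show ?case using assms by simp
next
  case (step x y)
  moreover have "y < n" using step(2) block_mat_dim by (auto simp: positive_entries_def)
  ultimately show ?case by (auto intro: rtrancl_on_into_rtrancl_on)
qed

text \<open>Strong connectivity includes a nonempty vertex set.\<close>

lemma n_pos: "0 < n" using q vertex_bounds by simp

lemma irreducible_block_mat: "irreducible_mat (block_mat m q s \<beta>)"
proof -
  have "verts (mat_digraph (block_mat m q s \<beta>)) = {..<n}"
    using block_mat_dim by (simp add: mat_digraph_def)
  then show ?thesis using block_mat_dim n_pos walk_exists_on
    by (auto simp: irreducible_mat_def strongly_connected_def reachable_def arcs_ends_mat_digraph)
qed

lemma strongly_connected_positive_subgraph:
  "strongly_connected (positive_subgraph (block_graph m q s) (arrow_weight \<beta>))"
proof -
  have "verts (positive_subgraph (block_graph m q s) (arrow_weight \<beta>)) = {..<n}"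
    by (simp add: positive_subgraph_def block_graph_def n_def)
  then show ?thesis using n_pos walk_exists_on
    by (auto simp: strongly_connected_def reachable_def arcs_ends_positive_subgraph)
qed

lemma primitive_block_mat:
  assumes "coprime q s"
  shows "primitive_mat (block_mat m q s \<beta>)"
proof (rule primitive_mat_coprime_cycles[OF block_mat_dim _ irreducible_block_mat _ short_cycle
      _ long_cycle assms])
  have "row_stochastic n (block_mat m q s \<beta>)"
    using \<beta> by (intro row_stochastic_block_mat) (auto simp: less_imp_le)
  then show "0 \<le> block_mat m q s \<beta> $$ (i, j)" if "i < n" "j < n" for i j
    using that by (simp add: row_stochastic_def)
qed (use q vertex_bounds in auto)

end

end

theorem propositionB1:
  fixes m q s :: nat and \<beta> :: "nat \<Rightarrow> real"
  defines "n0 \<equiv> max (m * q) s"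
    and "A \<equiv> block_mat m q s \<beta>"
  assumes "m > 0" and "q > 0" and "s > 0"
    and "s > (m - 1) * q" and "q < s"
    and "\<forall>j<m. 0 \<le> \<beta> j \<and> \<beta> j \<le> 1"
  shows
    "((\<forall>j<m. 0 < \<beta> j \<and> \<beta> j < 1) \<longrightarrow>
        irreducible_mat A \<and>
        strongly_connected (positive_subgraph (block_graph m q s) (arrow_weight \<beta>)) \<and>
        card (positive_entries A) = n0 + m \<and>
        card {i. i < n0 \<and> card {j. j < n0 \<and> A $$ (i, j) > 0} = 2} = m \<and>
        card {i. i < n0 \<and> card {j. j < n0 \<and> A $$ (i, j) > 0} = 1} = n0 - m \<and>
        (gcd q s = 1 \<longrightarrow> primitive_mat A)) \<and>
     (\<forall>n\<ge>n0.
        row_stochastic n (add_identity A (n - n0)) \<and>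
        (\<forall>z. complex_eigenvalue A z \<longrightarrow> complex_eigenvalue (add_identity A (n - n0)) z) \<and>
        (n = n0 \<longrightarrow> add_identity A (n - n0) = A))"
proof -
  interpret block_parameters m q s "graph_order m q s"
    using assms(3-7) by unfold_locales auto
  have n0: "graph_order m q s = n0" by (simp add: n0_def graph_order_def)
  have stochastic: "row_stochastic n0 A"
    using row_stochastic_block_mat[OF assms(8)] by (simp add: A_def n0)
  then have A: "A \<in> carrier_mat n0 n0" by (simp add: row_stochastic_def)
  \<comment> \<open>This is the case \<open>n = n0\<close>, where the three added blocks are
    empty.\<close>
  have "add_identity A 0 = A"
    using A by (intro eq_matI) (auto simp: add_identity_def)
  moreover have "row_stochastic n (add_identity A (n - n0))" if "n0 \<le> n" for n
    using row_stochastic_add_identity[OF stochastic, of "n - n0"] that by simp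
  ultimately show ?thesis
    using irreducible_block_mat[of \<beta>] strongly_connected_positive_subgraph[of \<beta>]
      card_positive_entries[of \<beta>]
      card_double_rows[of \<beta>] card_single_rows[of \<beta>] primitive_block_mat[of \<beta>]
      complex_eigenvalue_add_identity[OF A]
    unfolding n0 A_def[symmetric] coprime_iff_gcd_eq_1
    by (auto simp del: One_nat_def)
qed

end
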